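(* Suppose $2\le d<\omega$ and $2^{\aleph_0}\le\aleph_{d-1}$. Then for every sequence $\vec X=\langle X_0,\dots,X_{d-1}\rangle$ of perfect Polish spaces, $\mathsf{DDF}(\vec X)$ is not weakly $\omega$-partition subregular.
   Context: A Polish space is perfect if it has no isolated points. For perfect Polish $X_0,\dots,X_{n-1}$, DDF sets $Z\subseteq\prod_{i<n}X_i$ are defined by induction on $n$: for $n=1$, $Z$ is DDF iff dense; $Z\subseteq\prod_{i\le n}X_i$ is DDF iff its projection onto the first $n$ coordinates is DDF and the sections $Z_x=\{y\in X_n:(x,y)\in Z\}$ ($x$ in that projection) generate a filter of dense subsets of $X_n$ (every finite intersection is dense). $Z$ is somewhere-DDF if there are nonempty open $U_i\subseteq X_i$ with $Z\subseteq\prod U_i$ and $Z$ DDF as a subset of $\prod U_i$. $\mathsf{DDF}(\vec X)$ is the family of subsets of $\prod_{i<n}X_i$ containing a somewhere-DDF subset. A family $\mathcal H$ of subsets of $S$ is weakly $\omega$-partition subregular if for every partition $S=\bigcup_{\eta<\omega}P_\eta$ there is $\xi<\omega$ with $\bigcup_{\eta<\xi}P_\eta\in\mathcal H$. *)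

theory Defs
  imports "HOL-Analysis.Analysis"
begin

no_notation elt_set_eq (infix \<open>=o\<close> 50)
unbundle cardinal_syntax

section \<open>The cardinals $\aleph_n$\<close>

text \<open>HOL has no single type carrying all $\aleph_n$, and \<^const>\<open>cardSuc\<close> raises the type, so
  \<open>\<aleph>\<^sub>n\<close> is a property of a cardinal: \<open>is_aleph n r\<close> says that the cardinal \<open>r\<close> equals $\aleph_n$.
  The predecessor \<open>s\<close> can be sought on the type of \<open>r\<close> because it is smaller than \<open>r\<close>.\<close>

primrec is_aleph :: "nat \<Rightarrow> 'a rel \<Rightarrow> bool" where
  "is_aleph 0 r \<longleftrightarrow> r =o natLeq"
| "is_aleph (Suc n) r \<longleftrightarrow> (\<exists>s :: 'a rel. is_aleph n s \<and> r =o cardSuc s)"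

text \<open>\<open>le_aleph r n\<close> is $r \le \aleph_n$ for a cardinal \<open>r\<close>, written as the negation of
  $\aleph_n < r$: a cardinal less than \<open>r\<close> has a copy on the type of \<open>r\<close>, whereas $\aleph_n$ itself
  need not have one. Lemma \<open>le_aleph_iff\<close> below shows that this agrees with comparison to
  $\aleph_n$ wherever the latter lives.\<close>

definition le_aleph :: "'a rel \<Rightarrow> nat \<Rightarrow> bool" where
  "le_aleph r n \<longleftrightarrow> \<not> (\<exists>s :: 'a rel. is_aleph n s \<and> s <o r)"

lemma is_aleph_Card_order: "is_aleph n r \<Longrightarrow> Card_order r"
proof (induction n arbitrary: r)
  case 0
  then have "r =o natLeq"
    by simp
  then show ?case
    by (rule Card_order_ordIso[OF natLeq_Card_order])
next
  case (Suc n)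
  then obtain s :: "'a rel" where "is_aleph n s" "r =o cardSuc s"
    by auto
  then show ?case
    by (intro Card_order_ordIso[OF cardSuc_Card_order[OF Suc.IH]])
qed

lemma is_aleph_unique:
  fixes r :: "'a rel" and s :: "'b rel"
  shows "is_aleph n r \<Longrightarrow> is_aleph n s \<Longrightarrow> r =o s"
proof (induction n arbitrary: r s)
  case 0
  then have "r =o natLeq" "s =o natLeq"
    by simp_all
  then show ?case
    by (rule ordIso_transitive[OF _ ordIso_symmetric])
next
  case (Suc n)
  then obtain r' :: "'a rel" and s' :: "'b rel"
    where *: "is_aleph n r'" "r =o cardSuc r'" "is_aleph n s'" "s =o cardSuc s'"
    by auto
  have "cardSuc r' =o cardSuc s'"
    using cardSuc_invar_ordIso[OF is_aleph_Card_order[OF *(1)] is_aleph_Card_order[OF *(3)]]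
      Suc.IH[OF *(1,3)] by simp
  from ordIso_transitive[OF *(2) ordIso_transitive[OF this ordIso_symmetric[OF *(4)]]]
  show ?case .
qed

lemma ordLeq_copy:
  fixes r :: "'a rel" and s :: "'b rel"
  assumes "Card_order r" "r \<le>o s"
  obtains t :: "'b rel" where "Card_order t" "t =o r"
proof -
  have r: "|Field r| =o r"
    by (rule card_of_Field_ordIso[OF assms(1)])
  then have "|Field r| \<le>o s"
    by (rule ordIso_ordLeq_trans[OF _ assms(2)])
  then have "\<exists>B\<subseteq>Field s. |Field r| =o |B| \<and> |B| \<le>o s"
    by (rule internalize_card_of_ordLeq[THEN iffD1])
  then obtain B :: "'b set" where "|Field r| =o |B|"
    by auto
  then have "|B| =o r"
    by (rule ordIso_transitive[OF ordIso_symmetric r])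
  then show thesis
    by (rule that[OF card_of_Card_order])
qed

lemma is_aleph_transfer:
  fixes r :: "'a rel" and t :: "'b rel"
  assumes "is_aleph n r" "t =o r"
  shows "is_aleph n t"
  using assms
proof (induction n arbitrary: r t)
  case 0
  then have "r =o natLeq" "t =o r"
    by simp_all
  then show ?case
    using ordIso_transitive[of t r natLeq] by simp
next
  case (Suc n)
  then obtain s :: "'a rel" where s: "is_aleph n s" "r =o cardSuc s"
    by auto
  have cs: "Card_order s"
    by (rule is_aleph_Card_order[OF s(1)])
  have ts: "t =o cardSuc s"
    by (rule ordIso_transitive[OF Suc.prems(2) s(2)])
  have "s \<le>o t"
    by (rule ordLeq_ordIso_trans[OF cardSuc_ordLeq[OF cs] ordIso_symmetric[OF ts]])
  then obtain u :: "'b rel" where u: "Card_order u" "u =o s"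
    by (rule ordLeq_copy[OF cs])
  have "cardSuc s =o cardSuc u"
    using cardSuc_invar_ordIso[OF cs u(1)] ordIso_symmetric[OF u(2)] by simp
  then have "t =o cardSuc u"
    by (rule ordIso_transitive[OF ts])
  moreover have "is_aleph n u"
    by (rule Suc.IH[OF s(1) u(2)])
  ultimately show ?case
    by auto
qed

lemma le_aleph_iff:
  fixes r :: "'a rel" and k :: "'k rel"
  assumes "Card_order r" "is_aleph n k"
  shows "le_aleph r n \<longleftrightarrow> r \<le>o k"
proof -
  have ck: "Card_order k"
    by (rule is_aleph_Card_order[OF assms(2)])
  have "(\<exists>s :: 'a rel. is_aleph n s \<and> s <o r) \<longleftrightarrow> k <o r"
  proof
    assume "\<exists>s :: 'a rel. is_aleph n s \<and> s <o r"
    then obtain s :: "'a rel" where "is_aleph n s" "s <o r"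
      by auto
    then show "k <o r"
      by (rule ordIso_ordLess_trans[OF is_aleph_unique[OF assms(2)]])
  next
    assume kr: "k <o r"
    obtain t :: "'a rel" where t: "t =o k"
      by (rule ordLeq_copy[OF ck ordLess_imp_ordLeq[OF kr]])
    then show "\<exists>s :: 'a rel. is_aleph n s \<and> s <o r"
      using is_aleph_transfer[OF assms(2) t] ordIso_ordLess_trans[OF t kr] by auto
  qed
  moreover have "Well_order r" "Well_order k"
    using assms(1) ck by (simp_all add: card_order_on_def)
  ultimately show ?thesis
    unfolding le_aleph_def using not_ordLess_iff_ordLeq[of r k] by simp
qed

section \<open>Perfect Polish spaces and DDF sets\<close>

definition perfect_polish :: "'a topology \<Rightarrow> bool" where
  "perfect_polish T \<longleftrightarrow> completely_metrizable_space T \<and> separable_space T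
     \<and> (\<forall>x\<in>topspace T. \<not> openin T {x})"

definition dense_subset :: "'a topology \<Rightarrow> 'a set \<Rightarrow> bool" where
  "dense_subset T D \<longleftrightarrow> D \<subseteq> topspace T \<and> T closure_of D = topspace T"

definition section_at :: "(nat \<Rightarrow> 'a) set \<Rightarrow> nat \<Rightarrow> (nat \<Rightarrow> 'a) \<Rightarrow> 'a set" where
  "section_at Z n x = {y. x(n := y) \<in> Z}"

text \<open>Points of $\prod_{i<n} X_i$ are extensional functions on \<open>{..<n}\<close>, and the projection onto
  the first \<open>n\<close> coordinates is restriction to \<open>{..<n}\<close>. The notion is only meant for \<open>n \<ge> 1\<close>;
  the value at \<open>n = 0\<close> is a dummy.\<close>

fun ddf :: "(nat \<Rightarrow> 'a topology) \<Rightarrow> nat \<Rightarrow> (nat \<Rightarrow> 'a) set \<Rightarrow> bool" where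
  "ddf X 0 Z \<longleftrightarrow> False"
| "ddf X (Suc 0) Z \<longleftrightarrow> dense_subset (product_topology X {..<Suc 0}) Z"
| "ddf X (Suc (Suc m)) Z \<longleftrightarrow>
     (let n = Suc m; P = (\<lambda>z. restrict z {..<n}) ` Z in
        Z \<subseteq> (\<Pi>\<^sub>E i\<in>{..<Suc n}. topspace (X i))
        \<and> ddf X n P
        \<and> (\<forall>F. finite F \<and> F \<noteq> {} \<and> F \<subseteq> P \<longrightarrow> dense_subset (X n) (\<Inter>x\<in>F. section_at Z n x)))"

definition somewhere_ddf :: "(nat \<Rightarrow> 'a topology) \<Rightarrow> nat \<Rightarrow> (nat \<Rightarrow> 'a) set \<Rightarrow> bool" where
  "somewhere_ddf X n Z \<longleftrightarrow>
     (\<exists>U. (\<forall>i<n. openin (X i) (U i) \<and> U i \<noteq> {}) \<and> Z \<subseteq> Pi\<^sub>E {..<n} U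
        \<and> ddf (\<lambda>i. subtopology (X i) (U i)) n Z)"

definition DDF :: "(nat \<Rightarrow> 'a topology) \<Rightarrow> nat \<Rightarrow> (nat \<Rightarrow> 'a) set set" where
  "DDF X n = {A. A \<subseteq> (\<Pi>\<^sub>E i\<in>{..<n}. topspace (X i)) \<and> (\<exists>Z\<subseteq>A. somewhere_ddf X n Z)}"

text \<open>Pieces of a partition are allowed to be empty.\<close>

definition weakly_omega_partition_subregular :: "'b set \<Rightarrow> 'b set set \<Rightarrow> bool" where
  "weakly_omega_partition_subregular S H \<longleftrightarrow>
     (\<forall>P :: nat \<Rightarrow> 'b set. disjoint_family P \<and> (\<Union>\<eta>. P \<eta>) = S \<longrightarrow> (\<exists>\<xi>. (\<Union>\<eta><\<xi>. P \<eta>) \<in> H))"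

end

theory Submission
  imports Defs
begin

text \<open>
  Colour the product with countably many colours so that every colour class is the graph of a
  partial function in one coordinate direction: two points of the same colour that agree off that
  coordinate are equal. Such a Kuratowski--Sierpinski colouring of a product of \<open>n + 1\<close> sets of size
  at most $\aleph_n$ exists by induction on \<open>n\<close>: well-order the sets in type $\omega_n$, freeze the
  largest coordinate of a point, and colour the others by the induction hypothesis for the initial
  segment below it, of size at most $\aleph_{n-1}$. On the other hand a DDF set contains finite grids
  with all sides of size \<open>k\<close>, for each \<open>k\<close>. A colour class meets such a grid in at most
  \<open>k ^ (d - 1)\<close> points, so fewer than \<open>k\<close> colours cannot cover it.
\<close>

section \<open>Bounds by \<open>\<aleph>\<^sub>n\<close> for subsets and initial segments\<close>

lemma is_aleph_infinite: "is_aleph n r \<Longrightarrow> infinite (Field r)"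
proof (induction n arbitrary: r)
  case 0
  then have "r =o natLeq" by simp
  then have "natLeq \<le>o r" by (rule ordIso_imp_ordLeq[OF ordIso_symmetric])
  then show ?case
    using card_of_Well_order cinfinite_def cinfinite_mono natLeq_cinfinite by blast
next
  case (Suc n)
  then obtain s :: "'a rel" where s: "is_aleph n s" "r =o cardSuc s" by auto
  have "s \<le>o r"
    by (rule ordLeq_ordIso_trans[OF cardSuc_ordLeq[OF is_aleph_Card_order[OF s(1)]]
          ordIso_symmetric[OF s(2)]])
  then show ?case using Suc.IH[OF s(1)] cinfinite_def cinfinite_mono by blast
qed

text \<open>The orders may live on different types, so an \<open>\<aleph>\<^sub>n\<close> strictly
  below \<open>t\<close> is first copied to the type of \<open>r\<close>, where it contradicts the
  bound on \<open>r\<close>.\<close>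

lemma le_aleph_mono:
  fixes r :: "'a rel" and t :: "'b rel"
  assumes "le_aleph r n" "t \<le>o r"
  shows "le_aleph t n"
  unfolding le_aleph_def
proof
  assume "\<exists>s :: 'b rel. is_aleph n s \<and> s <o t"
  then obtain s :: "'b rel" where s: "is_aleph n s" "s <o t" by auto
  have sr: "s <o r" by (rule ordLess_ordLeq_trans[OF s(2) assms(2)])
  obtain u :: "'a rel" where u: "u =o s"
    by (rule ordLeq_copy[OF is_aleph_Card_order[OF s(1)] ordLess_imp_ordLeq[OF sr]])
  show False
    using assms(1) is_aleph_transfer[OF s(1) u] ordIso_ordLess_trans[OF u sr]
    unfolding le_aleph_def by blast
qed

lemma le_aleph_0_countable:
  assumes "le_aleph |W| 0"
  shows "countable W"
proof -
  have "\<not> natLeq <o |W|"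
  proof
    assume lt: "natLeq <o |W|"
    obtain t :: "'a rel" where t: "t =o natLeq"
      by (rule ordLeq_copy[OF natLeq_Card_order ordLess_imp_ordLeq[OF lt]])
    show False
      using assms t ordIso_ordLess_trans[OF t lt] unfolding le_aleph_def by auto
  qed
  then have "|W| \<le>o natLeq"
    by (simp add: natLeq_Well_order not_ordLess_iff_ordLeq card_of_Well_order)
  then show ?thesis
    unfolding countable_def
    by (metis card_of_nat card_of_ordLeq ordIso_symmetric ordLeq_ordIso_trans top_greatest)
qed

text \<open>Provides the drop by one aleph in the colouring induction. The segment is smaller than
  \<open>W\<close>; if \<open>s\<close> of size \<open>\<aleph>\<^sub>n\<close> lay strictly below
  it, then \<open>cardSuc s\<close> would still lie strictly below \<open>|W|\<close>.\<close>

lemma le_aleph_under: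
  assumes "le_aleph |W| (Suc n)" "a \<in> W"
  shows "le_aleph |under |W| a| n"
  unfolding le_aleph_def
proof
  let ?U = "under |W| a"
  assume "\<exists>s :: 'a rel. is_aleph n s \<and> s <o |?U|"
  then obtain s :: "'a rel" where s: "is_aleph n s" "s <o |?U|" by auto
  have cs: "Card_order s" by (rule is_aleph_Card_order[OF s(1)])
  have UW: "?U \<subseteq> W"
    using under_Field[of "|W|" a] by (simp add: Field_card_of)
  have wo: "Well_order |W|" by (rule card_of_Well_order)
  have "infinite ?U"
    using s is_aleph_infinite[OF s(1)] cinfinite_def cinfinite_mono ordLess_imp_ordLeq
    by (metis Field_card_of)
  then have "infinite W" using UW finite_subset by blast
  \<comment> \<open>An infinite cardinal has no largest element. So the closed segment up to
    \<open>a\<close> sits inside an open segment below some \<open>b\<close>, and open segments of a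
    cardinal are smaller.\<close>
  then obtain b where b: "b \<in> W" "a \<noteq> b" "(a, b) \<in> |W|"
    using infinite_Card_order_limit[of "|W|" a] assms(2) card_of_Card_order[of W]
    by (auto simp: Field_card_of)
  have "?U \<subseteq> underS |W| b"
  proof
    fix c assume c: "c \<in> ?U"
    then have ca: "(c, a) \<in> |W|" by (simp add: under_def)
    have "trans |W|" "antisym |W|"
      using wo by (auto simp: well_order_on_def linear_order_on_def partial_order_on_def preorder_on_def)
    then have "(c, b) \<in> |W|" "c \<noteq> b"
      using ca b by (auto dest: transD antisymD)
    then show "c \<in> underS |W| b" by (simp add: underS_def)
  qed
  then have "|?U| \<le>o |underS |W| b|" by (rule card_of_mono1)
  also have "|underS |W| b| <o |W|"
    using b card_of_Card_order[of W] by (intro card_of_underS) (simp_all add: Field_card_of)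
  finally have UltW: "|?U| <o |W|" .
  have "cardSuc s \<le>o |?U|"
    by (rule cardSuc_least[OF cs card_of_Card_order s(2)])
  then have lt: "cardSuc s <o |W|" by (rule ordLeq_ordLess_trans[OF _ UltW])
  obtain t :: "'a rel" where t: "t =o cardSuc s"
    by (rule ordLeq_copy[OF cardSuc_Card_order[OF cs] ordLess_imp_ordLeq[OF lt]])
  have "is_aleph (Suc n) t" using s(1) t by auto
  then show False
    using assms(1) ordIso_ordLess_trans[OF t lt] unfolding le_aleph_def by blast
qed

section \<open>Kuratowski-Sierpinski colourings\<close>

text \<open>The direction is part of the colour, so points of one colour share it. Points are not
  extensional and are compared on \<open>I\<close> only; hence the same \<open>x\<close> can be
  coloured over a smaller index set without restricting it.\<close>

definition directed_coloring :: "'i set \<Rightarrow> 'a set \<Rightarrow> (('i \<Rightarrow> 'a) \<Rightarrow> 'i \<times> nat) \<Rightarrow> bool" where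
  "directed_coloring I W F \<longleftrightarrow> (\<forall>x\<in>I \<rightarrow> W. fst (F x) \<in> I \<and>
    (\<forall>y\<in>I \<rightarrow> W. F x = F y \<and> (\<forall>j\<in>I - {fst (F x)}. x j = y j) \<longrightarrow> (\<forall>j\<in>I. x j = y j)))"

lemma directed_coloringD:
  assumes "directed_coloring I W F" "x \<in> I \<rightarrow> W"
  shows "fst (F x) \<in> I"
    and "\<lbrakk>y \<in> I \<rightarrow> W; F x = F y; \<And>j. j \<in> I - {fst (F x)} \<Longrightarrow> x j = y j; i \<in> I\<rbrakk> \<Longrightarrow> x i = y i"
  using assms unfolding directed_coloring_def by blast+

lemma directed_coloring_exists:
  assumes "le_aleph |W| n" "card I = Suc n"
  shows "\<exists>F. directed_coloring I W F"
  using assms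
proof (induction n arbitrary: W I)
  case 0
  obtain i where I: "I = {i}"
    using "0.prems"(2) by (auto simp: card_1_singleton_iff)
  \<comment> \<open>With a single coordinate, agreement off the direction is vacuous, so the colour
    alone must determine the point: an enumeration of the countable \<open>W\<close> does
    this.\<close>
  have "inj_on (to_nat_on W) W"
    using le_aleph_0_countable[OF "0.prems"(1)] by (rule inj_on_to_nat_on)
  then show ?case
    unfolding I
    by (intro exI[of _ "\<lambda>x. (i, to_nat_on W (x i))"])
      (auto simp: inj_on_def directed_coloring_def)
next
  case (Suc n)
  let ?r = "|W|"
  have finI: "finite I" "I \<noteq> {}"
    using Suc.prems(2) card.infinite by fastforce+
  have wo: "Well_order ?r" by (rule card_of_Well_order)
  have tot: "Total ?r" "Refl ?r" "trans ?r"
    using wo by (auto simp: well_order_on_def linear_order_on_def partial_order_on_def preorder_on_def)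
  have "\<exists>m\<in>I. \<forall>i\<in>I. (x i, x m) \<in> ?r" if x: "x \<in> I \<rightarrow> W" for x
    using finI x
  proof (induction I rule: finite_ne_induct)
    case (singleton i)
    then show ?case using tot(2) by (auto simp: refl_on_def Field_card_of)
  next
    case (insert k J)
    then obtain m where m: "m \<in> J" "\<forall>i\<in>J. (x i, x m) \<in> ?r" by auto
    have "x k \<in> W" "x m \<in> W" using insert.prems m by auto
    then consider "(x k, x m) \<in> ?r" | "(x m, x k) \<in> ?r" "(x k, x k) \<in> ?r"
      using tot(1,2) unfolding total_on_def refl_on_def by (metis Field_card_of)
    then show ?case
    proof cases
      case 1
      with m show ?thesis by auto
    next
      case 2
      with m show ?thesis using tot(3) by (intro bexI[of _ k]) (auto dest: transD)
    qed
  qed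
  \<comment> \<open>\<open>M x\<close> is a chosen index at which \<open>x\<close> attains its
    largest value; ties do not matter.\<close>
  then obtain M where M: "\<And>x. x \<in> I \<rightarrow> W \<Longrightarrow> M x \<in> I"
      "\<And>x i. x \<in> I \<rightarrow> W \<Longrightarrow> i \<in> I \<Longrightarrow> (x i, x (M x)) \<in> ?r"
    by metis
  have "\<exists>F. directed_coloring (I - {m}) (under ?r v) F" if "m \<in> I" "v \<in> W" for m v
    by (rule Suc.IH[OF le_aleph_under[OF Suc.prems(1) that(2)]])
      (use that finI Suc.prems(2) in simp)
  then obtain G where
    G: "\<And>m v. m \<in> I \<Longrightarrow> v \<in> W \<Longrightarrow> directed_coloring (I - {m}) (under ?r v) (G m v)"
    by metis
  define e where "e = to_nat_on I"
  have e: "inj_on e I" unfolding e_def using finI by (intro inj_on_to_nat_on countable_finite)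
  let ?G = "\<lambda>x. G (M x) (x (M x)) x"
  \<comment> \<open>The direction is inherited from the smaller colouring, hence differs from
    \<open>M x\<close>. The number also records \<open>M x\<close>, so that equal colours force
    maxima at the same index.\<close>
  define F where "F = (\<lambda>x. (fst (?G x), prod_encode (e (M x), snd (?G x))))"
  have inG: "x \<in> (I - {M x}) \<rightarrow> under ?r (x (M x))" if "x \<in> I \<rightarrow> W" for x
    using M[OF that] by (auto simp: under_def)
  have GM: "directed_coloring (I - {M x}) (under ?r (x (M x))) (G (M x) (x (M x)))"
    if "x \<in> I \<rightarrow> W" for x
    using that M(1)[OF that] by (intro G) auto
  have FI: "fst (F x) \<in> I - {M x}" if x: "x \<in> I \<rightarrow> W" for x
    using directed_coloringD(1)[OF GM[OF x] inG[OF x]] unfolding F_def by simp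
  have "x j = y j" if x: "x \<in> I \<rightarrow> W" and y: "y \<in> I \<rightarrow> W" and F: "F x = F y"
    and off: "\<forall>j\<in>I - {fst (F x)}. x j = y j" and j: "j \<in> I" for x y j
  proof -
    have "e (M x) = e (M y)" using F by (simp add: F_def)
    then have Meq: "M x = M y" using e M(1) x y by (auto dest: inj_onD)
    \<comment> \<open>The direction is not \<open>M x\<close>, so \<open>x\<close> and
      \<open>y\<close> agree there; both are then coloured by the same instance of
      \<open>G\<close>.\<close>
    have max_eq: "x (M x) = y (M x)" using off FI[OF x] M(1)[OF x] by (metis DiffD2 DiffI insertI1 singletonD)
    have Geq: "?G x = G (M x) (x (M x)) y"
      using F Meq max_eq by (simp add: F_def prod_eq_iff)
    show ?thesis
    proof (cases "j = M x")
      case False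
      show ?thesis
      proof (rule directed_coloringD(2)[OF GM[OF x] inG[OF x] _ Geq])
        show "y \<in> I - {M x} \<rightarrow> under ?r (x (M x))" using inG[OF y] Meq max_eq by simp
        show "x k = y k" if "k \<in> I - {M x} - {fst (?G x)}" for k
          by (rule off[rule_format]) (use that in \<open>simp add: F_def\<close>)
        show "j \<in> I - {M x}" using j False by simp
      qed
    qed (simp add: max_eq)
  qed
  then have "directed_coloring I W F"
    using FI unfolding directed_coloring_def by blast
  then show ?case by blast
qed

section \<open>Sizes of separable metrizable spaces, dense sets and open sets\<close>

text \<open>A point is determined by the set of pairs \<open>(c, k)\<close> with \<open>c\<close> in
  a countable dense set and within \<open>1 / (k + 1)\<close> of it: two points with the same pairs
  are closer than \<open>2 / (k + 1)\<close> for every \<open>k\<close>. This injects the space into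
  the subsets of the naturals.\<close>

lemma separable_metrizable_card_le:
  assumes "metrizable_space T" "separable_space T"
  shows "|topspace T| \<le>o ctwo ^c natLeq"
proof -
  obtain M d where Md: "Metric_space M d" "T = Metric_space.mtopology M d"
    using assms(1) unfolding metrizable_space_def by blast
  interpret Metric_space M d by (rule Md(1))
  obtain C where C: "countable C" "C \<subseteq> M" "mtopology closure_of C = M"
    using assms(2) unfolding Md(2) separable_space_def by auto
  define f where "f x = {prod_encode (to_nat_on C c, k) |c k. c \<in> C \<and> d x c < 1 / real (Suc k)}" for x
  have "inj_on f M"
  proof (rule inj_onI, rule ccontr)
    fix x y assume xy: "x \<in> M" "y \<in> M" "f x = f y" "x \<noteq> y"
    then have "0 < d x y / 2" by simp
    then obtain k where k: "1 / real (Suc k) < d x y / 2"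
      using nat_approx_posE by metis
    have "x \<in> mtopology closure_of C" using C xy by simp
    then have "\<exists>c\<in>C. c \<in> mball x (1 / real (Suc k))"
      unfolding metric_closure_of by simp
    then obtain c where c: "c \<in> C" "d x c < 1 / real (Suc k)" by auto
    then have "prod_encode (to_nat_on C c, k) \<in> f y"
      using xy(3) unfolding f_def by blast
    then have "d y c < 1 / real (Suc k)"
      unfolding f_def using c C(1) by (auto simp: prod_encode_eq inj_on_eq_iff[OF inj_on_to_nat_on])
    then have "d x y < 1 / real (Suc k) + 1 / real (Suc k)"
      using triangle[of x c y] c C(2) xy commute[of c y] by auto
    with k show False by simp
  qed
  then have "|M| \<le>o |Pow (UNIV :: nat set)|"
    unfolding card_of_ordLeq[symmetric] by auto
  also have "|Pow (UNIV :: nat set)| =o |Func (UNIV :: nat set) (UNIV :: bool set)|"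
    by (rule card_of_Pow_Func)
  also have "|Func (UNIV :: nat set) (UNIV :: bool set)| = ctwo ^c natLeq"
    by (simp add: cexp_def ctwo_def Field_natLeq Field_card_of)
  finally show ?thesis by (simp add: Md(2))
qed

text \<open>A finite set is closed in a T1 space, so if dense it would be the whole space.\<close>

lemma dense_subset_infinite:
  assumes "t1_space T" "infinite (topspace T)" "dense_subset T D"
  shows "infinite D"
  using assms unfolding dense_subset_def
  by (metis closure_of_closedin t1_space_closedin_finite)

text \<open>Removing all but one point from a finite open set removes a closed set and leaves an
  open singleton.\<close>

lemma infinite_open_of_no_isolated:
  assumes "t1_space T" "\<And>x. x \<in> topspace T \<Longrightarrow> \<not> openin T {x}" "openin T U" "U \<noteq> {}"
  shows "infinite U"
proof
  assume "finite U"
  obtain x where x: "x \<in> U" using assms(4) by auto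
  have UT: "U \<subseteq> topspace T" by (rule openin_subset[OF assms(3)])
  have "closedin T (U - {x})"
    using assms(1) \<open>finite U\<close> UT unfolding t1_space_closedin_finite by blast
  then have "openin T (U - (U - {x}))" by (rule openin_diff[OF assms(3)])
  moreover have "U - (U - {x}) = {x}" using x by auto
  ultimately show False using assms(2)[of x] x UT by auto
qed

section \<open>Finite grids and their colour classes\<close>

text \<open>The grid grows by one coordinate at a time. A grid in the projection is finite, so the
  sections over its points have a dense, hence infinite, intersection, and any \<open>k\<close>
  points of it form the next side.\<close>

lemma ddf_contains_grid:
  assumes "ddf X n Z" "\<And>i. i < n \<Longrightarrow> t1_space (X i)" "\<And>i. i < n \<Longrightarrow> infinite (topspace (X i))"
    and "0 < k"
  shows "\<exists>G. (\<forall>i<n. finite (G i) \<and> card (G i) = k) \<and> Pi\<^sub>E {..<n} G \<subseteq> Z"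
  using assms(1-3)
proof (induction n arbitrary: Z)
  case 0
  then show ?case by simp
next
  case (Suc n)
  show ?case
  proof (cases n)
    case 0
    let ?T = "product_topology X {..<Suc 0}"
    have ts: "topspace ?T = Pi\<^sub>E {0} (\<lambda>i. topspace (X i))" by (simp add: lessThan_Suc)
    have Z: "dense_subset ?T Z" using Suc.prems(1) 0 by simp
    have inf0: "infinite (topspace (X 0))" using Suc.prems(3) by simp
    have "infinite (topspace ?T)"
      using inf0 unfolding ts by (auto simp: finite_PiE_iff PiE_eq_empty_iff)
    then have "infinite Z"
      using Suc.prems(2) 0 Z by (intro dense_subset_infinite[OF _ _ Z])
        (auto simp: t1_space_product_topology)
    moreover have ZT: "Z \<subseteq> Pi\<^sub>E {0} (\<lambda>i. topspace (X i))"
      using Z ts by (simp add: dense_subset_def)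
    \<comment> \<open>Points of the one-factor product are functions on \<open>{0}\<close>;
      evaluation at \<open>0\<close> turns the infinite \<open>Z\<close> into infinitely many values
      for the side.\<close>
    have inj: "inj_on (\<lambda>z. z 0) Z"
    proof (rule inj_onI)
      fix z w assume "z \<in> Z" "w \<in> Z" "z 0 = w 0"
      then show "z = w" using ZT by (intro PiE_ext[of z "{0}" _ w]) auto
    qed
    ultimately have "infinite ((\<lambda>z. z 0) ` Z)" by (simp add: finite_image_iff)
    then obtain B where B: "finite B" "card B = k" "B \<subseteq> (\<lambda>z. z 0) ` Z"
      using infinite_arbitrarily_large by metis
    have "Pi\<^sub>E {..<Suc n} (\<lambda>_. B) \<subseteq> Z"
    proof
      fix w assume w: "w \<in> Pi\<^sub>E {..<Suc n} (\<lambda>_. B)"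
      then have "w 0 \<in> B" using 0 by auto
      then obtain z where z: "z \<in> Z" "w 0 = z 0" using B(3) by auto
      have "w \<in> {0} \<rightarrow>\<^sub>E B" using w 0 by (simp add: lessThan_Suc)
      moreover have "z \<in> Pi\<^sub>E {0} (\<lambda>i. topspace (X i))" using z ZT by blast
      ultimately have "w = z" using z(2) by (intro extensionalityI[of w "{0}" z]) (auto simp: PiE_iff)
      then show "w \<in> Z" using z by simp
    qed
    then show ?thesis using B 0 by (intro exI[of _ "\<lambda>_. B"]) auto
  next
    case (Suc m)
    let ?P = "(\<lambda>z. restrict z {..<n}) ` Z"
    have P: "ddf X n ?P"
      and filt: "\<And>A. finite A \<Longrightarrow> A \<noteq> {} \<Longrightarrow> A \<subseteq> ?P \<Longrightarrow> dense_subset (X n) (\<Inter>x\<in>A. section_at Z n x)"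
      using Suc.prems(1) unfolding Suc by (simp_all add: Let_def)
    obtain G where G: "\<forall>i<n. finite (G i) \<and> card (G i) = k" "Pi\<^sub>E {..<n} G \<subseteq> ?P"
      using Suc.IH[OF P] Suc.prems(2,3) by (metis less_SucI)
    let ?A = "Pi\<^sub>E {..<n} G"
    have "finite ?A" using G(1) by (intro finite_PiE) auto
    \<comment> \<open>The filter condition concerns nonempty finite families; \<open>0 < k\<close>
      ensures that the grid is one.\<close>
    moreover have "?A \<noteq> {}" using G(1) assms(4) by (auto simp: PiE_eq_empty_iff)
    ultimately have "infinite (\<Inter>x\<in>?A. section_at Z n x)"
      using Suc.prems(2,3) G(2) by (intro dense_subset_infinite[OF _ _ filt]) auto
    then obtain B where B: "finite B" "card B = k" "B \<subseteq> (\<Inter>x\<in>?A. section_at Z n x)"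
      using infinite_arbitrarily_large by metis
    have "Pi\<^sub>E {..<Suc n} (G(n := B)) \<subseteq> Z"
    proof
      fix z assume z: "z \<in> Pi\<^sub>E {..<Suc n} (G(n := B))"
      then have zn: "z n \<in> B" and "\<forall>i<n. z i \<in> G i"
        by (auto simp: PiE_iff less_Suc_eq split: if_splits)
      then have "restrict z {..<n} \<in> ?A" by auto
      then have "(restrict z {..<n})(n := z n) \<in> Z"
        using B(3) zn unfolding section_at_def by blast
      moreover have "(restrict z {..<n})(n := z n) = z"
        using z by (simp add: fun_eq_iff PiE_iff extensional_def less_Suc_eq)
      ultimately show "z \<in> Z" by simp
    qed
    moreover have "\<forall>i<Suc n. finite ((G(n := B)) i) \<and> card ((G(n := B)) i) = k"
      using G(1) B by (simp add: less_Suc_eq)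
    ultimately show ?thesis by blast
  qed
qed

text \<open>Forgetting coordinate \<open>i\<close> is injective on \<open>A\<close>, with image in a
  grid that has one side fewer.\<close>

lemma card_directed_color_class:
  assumes fin: "finite I" and G: "\<forall>i\<in>I. finite (G i) \<and> card (G i) = k"
    and i: "i \<in> I" and A: "A \<subseteq> Pi\<^sub>E I G"
    and inj: "\<And>x y. x \<in> A \<Longrightarrow> y \<in> A \<Longrightarrow> \<forall>j\<in>I - {i}. x j = y j \<Longrightarrow> \<forall>j\<in>I. x j = y j"
  shows "card A \<le> k ^ (card I - 1)"
proof -
  have "card A \<le> card (Pi\<^sub>E (I - {i}) G)"
  proof (rule card_inj_on_le)
    show "inj_on (\<lambda>x. restrict x (I - {i})) A"
    proof (rule inj_onI)
      fix x y assume xy: "x \<in> A" "y \<in> A" "restrict x (I - {i}) = restrict y (I - {i})"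
      then have "\<forall>j\<in>I - {i}. x j = y j" by (metis restrict_apply')
      then have "\<forall>j\<in>I. x j = y j" by (rule inj[OF xy(1,2)])
      then show "x = y" using xy A by (intro PiE_ext[of x I G y]) auto
    qed
    show "(\<lambda>x. restrict x (I - {i})) ` A \<subseteq> Pi\<^sub>E (I - {i}) G"
      using A by (force simp: PiE_iff)
    show "finite (Pi\<^sub>E (I - {i}) G)" using fin G by (intro finite_PiE) auto
  qed
  also have "\<dots> = k ^ (card I - 1)"
    using fin G i by (simp add: card_PiE)
  finally show ?thesis .
qed

section \<open>Covering a grid by too few colours\<close>

theorem theorem4p6:
  fixes X :: "nat \<Rightarrow> 'a topology" and d :: nat
  assumes "2 \<le> d"
    and "le_aleph (ctwo ^c natLeq) (d - 1)"
    and "\<And>i. i < d \<Longrightarrow> perfect_polish (X i)"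
  shows "\<not> weakly_omega_partition_subregular (\<Pi>\<^sub>E i\<in>{..<d}. topspace (X i)) (DDF X d)"
proof
  let ?S = "\<Pi>\<^sub>E i\<in>{..<d}. topspace (X i)"
  let ?c = "ctwo ^c natLeq"
  assume wops: "weakly_omega_partition_subregular ?S (DDF X d)"
  \<comment> \<open>The colouring uses one set for all coordinates; a finite union of the spaces
    still has size at most the continuum.\<close>
  define W where "W = (\<Union>i<d. topspace (X i))"
  have t1: "t1_space (X i)" if "i < d" for i
    using assms(3)[OF that] unfolding perfect_polish_def
    by (simp add: completely_metrizable_imp_metrizable_space metrizable_imp_t1_space)
  have "natLeq \<le>o ?c" by (rule ordLess_imp_ordLeq[OF ordLess_ctwo_cexp[OF natLeq_Card_order]])
  then have infc: "infinite (Field ?c)"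
    using cinfinite_def cinfinite_mono natLeq_cinfinite by blast
  have Wle: "|W| \<le>o ?c"
    unfolding W_def
  proof (rule card_of_UNION_ordLeq_infinite_Field[OF infc Card_order_cexp])
    show "|{..<d}| \<le>o ?c"
      using infc Card_order_cexp[of ctwo natLeq] card_of_Well_order[of "{..<d}"]
      by (intro ordLess_imp_ordLeq finite_ordLess_infinite)
        (simp_all add: card_order_on_def Field_card_of)
    show "\<forall>i\<in>{..<d}. |topspace (X i)| \<le>o ?c"
      using assms(3) unfolding perfect_polish_def
      by (auto intro!: separable_metrizable_card_le completely_metrizable_imp_metrizable_space)
  qed
  have "le_aleph |W| (d - 1)" by (rule le_aleph_mono[OF assms(2) Wle])
  then obtain F where F: "directed_coloring {..<d} W F"
    using directed_coloring_exists[of W "d - 1" "{..<d}"] assms(1) by auto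
  have SW: "x \<in> {..<d} \<rightarrow> W" if "x \<in> ?S" for x
    using that unfolding W_def by auto
  \<comment> \<open>Each natural number codes a pair of direction and number; colours that are not
    attained give empty pieces.\<close>
  define P where "P \<eta> = {x \<in> ?S. F x = prod_decode \<eta>}" for \<eta>
  have "disjoint_family P"
    unfolding P_def disjoint_family_on_def using inj_prod_decode[of UNIV] by (auto dest: injD)
  moreover have "(\<Union>\<eta>. P \<eta>) = ?S"
  proof (intro equalityI subsetI)
    fix x assume "x \<in> ?S"
    then have "x \<in> P (prod_encode (F x))" unfolding P_def by simp
    then show "x \<in> (\<Union>\<eta>. P \<eta>)" by blast
  qed (simp add: P_def)
  ultimately obtain \<xi> where "(\<Union>\<eta><\<xi>. P \<eta>) \<in> DDF X d"
    using wops unfolding weakly_omega_partition_subregular_def by blast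
  then obtain Z where Z: "Z \<subseteq> (\<Union>\<eta><\<xi>. P \<eta>)" "somewhere_ddf X d Z"
    unfolding DDF_def by auto
  then obtain U where U: "\<And>i. i < d \<Longrightarrow> openin (X i) (U i) \<and> U i \<noteq> {}"
      "ddf (\<lambda>i. subtopology (X i) (U i)) d Z"
    unfolding somewhere_ddf_def by auto
  have Uinf: "infinite (U i)" if "i < d" for i
    using assms(3)[OF that] U(1)[OF that] t1[OF that] unfolding perfect_polish_def
    by (intro infinite_open_of_no_isolated[of "X i"]) auto
  \<comment> \<open>A side longer than the number of colours makes
    \<open>\<xi> * ?k ^ (d - 1)\<close> smaller than the size \<open>?k ^ d\<close> of the
    grid.\<close>
  let ?k = "Suc \<xi>"
  have "\<exists>G. (\<forall>i<d. finite (G i) \<and> card (G i) = ?k) \<and> Pi\<^sub>E {..<d} G \<subseteq> Z"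
  proof (rule ddf_contains_grid[OF U(2)])
    fix i assume i: "i < d"
    show "t1_space (subtopology (X i) (U i))" by (rule t1_space_subtopology[OF t1[OF i]])
    have "topspace (subtopology (X i) (U i)) = U i"
      using U(1)[OF i] openin_subset by (auto simp: topspace_subtopology)
    then show "infinite (topspace (subtopology (X i) (U i)))" using Uinf[OF i] by simp
  qed simp
  then obtain G where G: "\<forall>i\<in>{..<d}. finite (G i) \<and> card (G i) = ?k" "Pi\<^sub>E {..<d} G \<subseteq> Z"
    by auto
  let ?G = "Pi\<^sub>E {..<d} G"
  have small: "card (?G \<inter> P \<eta>) \<le> ?k ^ (d - 1)" for \<eta>
  \<comment> \<open>Only for an attained colour is the decoded direction known to be below
    \<open>d\<close>.\<close>
  proof (cases "?G \<inter> P \<eta> = {}")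
    case False
    then obtain x0 where x0: "x0 \<in> P \<eta>" by auto
    let ?i = "fst (prod_decode \<eta>)"
    have "F x0 = prod_decode \<eta>" "x0 \<in> ?S"
      using x0 unfolding P_def by simp_all
    then have i: "?i \<in> {..<d}"
      using directed_coloringD(1)[OF F SW] by metis
    have inj: "\<forall>j\<in>{..<d}. x j = y j" if "x \<in> ?G \<inter> P \<eta>" "y \<in> ?G \<inter> P \<eta>"
      and off: "\<forall>j\<in>{..<d} - {?i}. x j = y j" for x y
    proof -
      have xy: "F x = prod_decode \<eta>" "F y = prod_decode \<eta>" "x \<in> ?S" "y \<in> ?S"
        using that unfolding P_def by simp_all
      show ?thesis
      proof
        fix j assume j: "j \<in> {..<d}"
        show "x j = y j"
        proof (rule directed_coloringD(2)[OF F SW[OF xy(3)] SW[OF xy(4)]])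
          show "F x = F y" using xy(1,2) by simp
          show "x i = y i" if "i \<in> {..<d} - {fst (F x)}" for i
            by (rule off[rule_format]) (use that in \<open>simp add: xy(1)\<close>)
        qed (rule j)
      qed
    qed
    have "card (?G \<inter> P \<eta>) \<le> ?k ^ (card {..<d} - 1)"
      by (rule card_directed_color_class[OF finite_lessThan G(1) i Int_lower1 inj])
    then show ?thesis by simp
  qed simp
  have "?k * ?k ^ (d - 1) = ?k ^ d"
    using assms(1) by (metis power_eq_if not_numeral_le_zero)
  also have "\<dots> = card ?G" using G(1) by (simp add: card_PiE)
  also have "?G = (\<Union>\<eta><\<xi>. ?G \<inter> P \<eta>)" using G(2) Z(1) by blast
  also have "card \<dots> \<le> (\<Sum>\<eta><\<xi>. card (?G \<inter> P \<eta>))" by (rule card_UN_le) simp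
  also have "\<dots> \<le> \<xi> * ?k ^ (d - 1)" using sum_bounded_above[of "{..<\<xi>}", OF small] by simp
  finally show False by simp
qed

end
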